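(* Let $\mathbf{d}=(d_1,\ldots,d_n)$ be an arranged degree sequence, and let $$\ell^*=\min\Big\{\ell\ge 0,\ 2\ell\le n\ :\ \sum_{i=1}^{2\ell}\min\{d_i-1,k\}\ge\sum_{i=2\ell+1}^{2\ell+k}d_i\ \text{ for all } k=1,\ldots,n-2\ell\Big\}.$$ Then every maximal matching $M$ in every realization of $\mathbf{d}$ satisfies $|M|\ge\ell^*$.
   Context: Arranged means $d_1\ge\cdots\ge d_n$. A realization of $\mathbf{d}$ is a simple graph (with vertex labelling) whose degree sequence is $\mathbf{d}$. A matching is a set of pairwise disjoint edges; it is maximal if it is not a proper subset of another matching. *)

theory Defs
  imports Complex_Main
begin

text \<open>Graphs are given by a vertex set and a set of edges, an edge being a two-element
  set of vertices. A sequence \<open>d\<^sub>1, \<dots>, d\<^sub>n\<close> is a function of which only the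
  values at \<open>1, \<dots>, n\<close> matter.\<close>

definition simple_graph :: "'a set \<Rightarrow> 'a set set \<Rightarrow> bool" where
  "simple_graph V E \<longleftrightarrow> finite V \<and> (\<forall>e\<in>E. e \<subseteq> V \<and> card e = 2)"

definition degree :: "'a set set \<Rightarrow> 'a \<Rightarrow> nat" where
  "degree E v = card {e \<in> E. v \<in> e}"

definition arranged :: "nat \<Rightarrow> (nat \<Rightarrow> nat) \<Rightarrow> bool" where
  "arranged n d \<longleftrightarrow> antimono_on {1..n} d"

text \<open>The labelling \<open>lab\<close> enumerates the vertices so that the \<open>i\<close>-th one has degree \<open>d\<^sub>i\<close>.\<close>

definition realization ::
    "nat \<Rightarrow> (nat \<Rightarrow> nat) \<Rightarrow> 'a set \<Rightarrow> 'a set set \<Rightarrow> (nat \<Rightarrow> 'a) \<Rightarrow> bool" where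
  "realization n d V E lab \<longleftrightarrow>
     simple_graph V E \<and> bij_betw lab {1..n} V \<and> (\<forall>i\<in>{1..n}. degree E (lab i) = d i)"

definition matching :: "'a set set \<Rightarrow> 'a set set \<Rightarrow> bool" where
  "matching E M \<longleftrightarrow> M \<subseteq> E \<and> pairwise disjnt M"

definition maximal_matching :: "'a set set \<Rightarrow> 'a set set \<Rightarrow> bool" where
  "maximal_matching E M \<longleftrightarrow> matching E M \<and> \<not> (\<exists>M'. matching E M' \<and> M \<subset> M')"

text \<open>The sums are taken over the integers, so that \<open>d\<^sub>i - 1\<close> is \<open>-1\<close> when \<open>d\<^sub>i = 0\<close>.
  The set below is finite, and it is nonempty whenever \<open>d\<close> is the arranged degree sequence
  of a graph: it contains the size of every maximal matching.\<close>

definition ell_star :: "nat \<Rightarrow> (nat \<Rightarrow> nat) \<Rightarrow> nat" where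
  "ell_star n d = Min {l. 2 * l \<le> n \<and>
     (\<forall>k\<in>{1..n - 2 * l}.
        (\<Sum>i=1..2 * l. min (int (d i) - 1) (int k)) \<ge> (\<Sum>i=2 * l + 1..2 * l + k. int (d i)))}"

end

theory Submission
  imports Defs
begin

text \<open>The vertices missed by a maximal matching \<open>M\<close> with \<open>\<ell>\<close> edges form an independent set.
  Any \<open>k\<close> of them therefore send all their edges to the \<open>2\<ell>\<close> covered vertices, and a covered
  vertex \<open>c\<close> receives at most \<open>min {deg c - 1, k}\<close> of these, as its matching edge is not among
  them. Among the first \<open>2\<ell> + k\<close> vertices at least \<open>k\<close> are uncovered; since the sequence is
  arranged, replacing the covered vertices by the first \<open>2\<ell>\<close> ones, and those \<open>k\<close> uncovered
  vertices by the next \<open>k\<close> ones, gives the inequality defining \<open>\<ell>*\<close> at \<open>\<ell> = |M|\<close>.\<close>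

text \<open>An exchange argument: \<open>A\<close> and \<open>{1..m}\<close> have equal size, so a
  bijection replaces the elements of \<open>A\<close> beyond \<open>m\<close> by the indices up to
  \<open>m\<close> that \<open>A\<close> misses. Each replacement lowers the index, hence does not
  lower \<open>f\<close>.\<close>

lemma sum_antimono_le_initial:
  fixes f :: "nat \<Rightarrow> int"
  assumes f: "antimono_on {1..n} f" and A: "A \<subseteq> {1..n}" "card A = m"
  shows "sum f A \<le> sum f {1..m}"
proof -
  define B where "B = {1..m}"
  have fin: "finite A" "finite B"
    using A finite_subset unfolding B_def by auto
  have mn: "m \<le> n"
    using card_mono[OF _ A(1)] A(2) by simp
  have cards: "card (A - B) = card (B - A)"
    using fin A(2) card_Diff_subset_Int[of A B] card_Diff_subset_Int[of B A]
    by (simp add: B_def Int_commute)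
  then obtain g where g: "bij_betw g (A - B) (B - A)"
    using fin finite_same_card_bij by blast
  have "sum f (A - B) \<le> (\<Sum>x\<in>A - B. f (g x))"
  proof (rule sum_mono)
    fix x assume x: "x \<in> A - B"
    then have "g x \<in> B - A"
      using g bij_betwE by blast
    then have "g x \<le> x" "g x \<in> {1..n}" "x \<in> {1..n}"
      using x A(1) mn by (auto simp: B_def)
    then show "f x \<le> f (g x)"
      using f by (auto simp: monotone_on_def)
  qed
  also have "\<dots> = sum f (B - A)"
    using g by (rule sum.reindex_bij_betw)
  finally have "sum f (A - B) \<le> sum f (B - A)" .
  then show ?thesis
    using sum.Int_Diff[OF fin(1), of f B] sum.Int_Diff[OF fin(2), of f A]
    by (simp add: Int_commute B_def)
qed

text \<open>Dual to the previous bound by complementation: the rest of \<open>{1..m + k}\<close> has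
  \<open>m\<close> elements, so its sum is at most that of the first \<open>m\<close>.\<close>

lemma sum_antimono_ge_final:
  fixes f :: "nat \<Rightarrow> int"
  assumes f: "antimono_on {1..m + k} f" and A: "A \<subseteq> {1..m + k}" "card A = k"
  shows "sum f {m + 1..m + k} \<le> sum f A"
proof -
  have "card ({1..m + k} - A) = m"
    using A by (simp add: card_Diff_subset finite_subset)
  then have "sum f ({1..m + k} - A) \<le> sum f {1..m}"
    using f by (intro sum_antimono_le_initial) auto
  moreover have "sum f {1..m + k} = sum f ({1..m + k} - A) + sum f A"
    using A by (intro sum.subset_diff) auto
  moreover have "sum f {1..m + k} = sum f {1..m} + sum f {m + 1..m + k}"
    using sum.ub_add_nat[of 1 m f k] by simp
  ultimately show ?thesis
    by linarith
qed

lemma simple_graph_finite_edges: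
  "simple_graph V E \<Longrightarrow> finite E"
  by (rule finite_subset[of _ "Pow V"]) (auto simp: simple_graph_def)

lemma card_matching_vertices:
  assumes "simple_graph V E" "matching E M"
  shows "card (\<Union>M) = 2 * card M"
proof -
  have two: "card e = 2" if "e \<in> M" for e
    using assms that by (auto simp: simple_graph_def matching_def)
  have "card (\<Union>M) = sum card M"
    using assms(2) two card_eq_0_iff
    by (intro card_Union_disjoint) (fastforce simp: matching_def)+
  then show ?thesis
    using two by simp
qed

lemma maximal_matching_meets_edge:
  assumes "simple_graph V E" "maximal_matching E M" "e \<in> E"
  shows "e \<inter> \<Union>M \<noteq> {}"
proof
  assume disj: "e \<inter> \<Union>M = {}"
  have M: "M \<subseteq> E" "pairwise disjnt M"
    using assms(2) by (auto simp: maximal_matching_def matching_def)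
  \<comment> \<open>Disjointness from \<open>\<Union>M\<close> excludes \<open>e\<close> from
    \<open>M\<close> only because \<open>e\<close> is nonempty; this makes the inclusion
    strict.\<close>
  have "e \<noteq> {}"
    using assms(1,3) by (auto simp: simple_graph_def)
  then have "M \<subset> insert e M"
    using disj by auto
  moreover have "matching E (insert e M)"
    using M assms(3) disj by (auto simp: matching_def pairwise_insert disjnt_def)
  ultimately show False
    using assms(2) by (auto simp: maximal_matching_def)
qed

text \<open>Double counting of the edges meeting \<open>T\<close>, once from their ends in
  \<open>T\<close> and once from their covered ends.\<close>

lemma sum_degree_uncovered_le:
  assumes G: "simple_graph V E" and M: "maximal_matching E M"
    and T: "T \<subseteq> V" "T \<inter> \<Union>M = {}"
  shows "(\<Sum>t\<in>T. int (degree E t))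
    \<le> (\<Sum>c\<in>\<Union>M. min (int (degree E c) - 1) (int (card T)))"
proof -
  define F where "F = {e \<in> E. e \<inter> T \<noteq> {}}"
  have finE: "finite E"
    using G by (rule simple_graph_finite_edges)
  have finT: "finite T"
    using G T(1) finite_subset by (auto simp: simple_graph_def)
  have ME: "M \<subseteq> E"
    using M by (auto simp: maximal_matching_def matching_def)
  have finUM: "finite (\<Union>M)"
    using G ME by (meson Sup_least finite_subset simple_graph_def subsetD)
  have edge: "\<exists>c\<in>\<Union>M. e = {c, t}" if e: "e \<in> E" and t: "t \<in> e" "t \<in> T" for e t
  proof -
    obtain c where c: "c \<in> e" "c \<in> \<Union>M"
      using maximal_matching_meets_edge[OF G M e] by auto
    then have "c \<noteq> t"
      using t T(2) by auto
    moreover have "card e = 2"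
      using G e by (simp add: simple_graph_def)
    ultimately have "e = {c, t}"
      using c t by (auto simp: card_2_iff)
    then show ?thesis
      using c by auto
  qed
  \<comment> \<open>By \<open>edge\<close>, no edge has both ends in \<open>T\<close>, so the stars
    of distinct vertices of \<open>T\<close> are disjoint.\<close>
  have "(\<Sum>t\<in>T. degree E t) = card (\<Union>t\<in>T. {e \<in> E. t \<in> e})"
    unfolding degree_def
  proof (rule card_UN_disjoint[symmetric])
    show "\<forall>s\<in>T. \<forall>t\<in>T. s \<noteq> t \<longrightarrow> {e \<in> E. s \<in> e} \<inter> {e \<in> E. t \<in> e} = {}"
    proof (intro ballI impI equals0I)
      fix s t e
      assume "s \<in> T" "t \<in> T" "s \<noteq> t" "e \<in> {e \<in> E. s \<in> e} \<inter> {e \<in> E. t \<in> e}"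
      then show False
        using edge[of e s] T(2) by auto
    qed
  qed (use finT finE in auto)
  \<comment> \<open>Both unions equal \<open>F\<close>, since every edge meets
    \<open>\<Union>M\<close>.\<close>
  also have "(\<Union>t\<in>T. {e \<in> E. t \<in> e}) = (\<Union>c\<in>\<Union>M. {e \<in> F. c \<in> e})"
    using maximal_matching_meets_edge[OF G M] by (fastforce simp: F_def)
  also have "card \<dots> \<le> (\<Sum>c\<in>\<Union>M. card {e \<in> F. c \<in> e})"
    using finUM by (rule card_UN_le)
  finally have "(\<Sum>t\<in>T. int (degree E t)) \<le> (\<Sum>c\<in>\<Union>M. int (card {e \<in> F. c \<in> e}))"
    by (metis of_nat_le_iff of_nat_sum)
  also have "\<dots> \<le> (\<Sum>c\<in>\<Union>M. min (int (degree E c) - 1) (int (card T)))"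
  proof (rule sum_mono)
    fix c assume c: "c \<in> \<Union>M"
    then obtain m where m: "m \<in> M" "c \<in> m"
      by auto
    \<comment> \<open>The edge \<open>m\<close> lies inside \<open>\<Union>M\<close>, so it misses
      \<open>T\<close> and is not in \<open>F\<close>; this yields the \<open>-1\<close>.\<close>
    have "{e \<in> F. c \<in> e} \<subseteq> {e \<in> E. c \<in> e} - {m}"
      using m T(2) by (auto simp: F_def)
    then have "card {e \<in> F. c \<in> e} \<le> card ({e \<in> E. c \<in> e} - {m})"
      using finE by (intro card_mono) auto
    also have "\<dots> < degree E c"
      unfolding degree_def using finE m ME by (intro card_Diff1_less) auto
    finally have "int (card {e \<in> F. c \<in> e}) \<le> int (degree E c) - 1"
      by simp
    \<comment> \<open>An edge of \<open>F\<close> at \<open>c\<close> is determined by its end in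
      \<open>T\<close>, which gives the bound \<open>card T\<close>.\<close>
    moreover have "{e \<in> F. c \<in> e} \<subseteq> (\<lambda>t. {c, t}) ` T"
    proof
      fix e assume e: "e \<in> {e \<in> F. c \<in> e}"
      then obtain t where t: "t \<in> e" "t \<in> T"
        by (auto simp: F_def)
      then have "e = {c, t}"
        using edge[of e t] e c T(2) by (auto simp: F_def)
      then show "e \<in> (\<lambda>t. {c, t}) ` T"
        using t by auto
    qed
    then have "card {e \<in> F. c \<in> e} \<le> card T"
      by (rule surj_card_le[OF finT])
    ultimately show "int (card {e \<in> F. c \<in> e}) \<le> min (int (degree E c) - 1) (int (card T))"
      by simp
  qed
  finally show ?thesis .
qed

theorem theorem5p2:
  fixes n :: nat and d :: "nat \<Rightarrow> nat"
    and V :: "'a set" and E M :: "'a set set" and lab :: "nat \<Rightarrow> 'a"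
  assumes "arranged n d"
    and "realization n d V E lab"
    and "maximal_matching E M"
  shows "card M \<ge> ell_star n d"
proof -
  define L where "L = {l. 2 * l \<le> n \<and>
     (\<forall>k\<in>{1..n - 2 * l}.
        (\<Sum>i=1..2 * l. min (int (d i) - 1) (int k)) \<ge> (\<Sum>i=2 * l + 1..2 * l + k. int (d i)))}"
  define l where "l = card M"
  define C where "C = {i \<in> {1..n}. lab i \<in> \<Union>M}"
  have G: "simple_graph V E" and lab: "bij_betw lab {1..n} V"
    and deg: "\<And>i. i \<in> {1..n} \<Longrightarrow> degree E (lab i) = d i"
    using assms(2) by (auto simp: realization_def)
  have mat: "matching E M"
    using assms(3) by (simp add: maximal_matching_def)
  have UM: "\<Union>M \<subseteq> V"
    using mat G by (fastforce simp: matching_def simple_graph_def)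
  have inj: "inj_on lab {1..n}"
    using lab by (simp add: bij_betw_def)
  have labC: "lab ` C = \<Union>M"
    using UM bij_betw_imp_surj_on[OF lab] unfolding C_def by blast
  have Cn: "C \<subseteq> {1..n}"
    by (auto simp: C_def)
  have cardC: "card C = 2 * l"
    using card_image[OF inj_on_subset[OF inj Cn]] labC card_matching_vertices[OF G mat]
    by (simp add: l_def)
  have "2 * l \<le> n"
    using card_mono[OF _ Cn] cardC by simp
  moreover have "(\<Sum>i=2 * l + 1..2 * l + k. int (d i))
      \<le> (\<Sum>i=1..2 * l. min (int (d i) - 1) (int k))" if k: "k \<in> {1..n - 2 * l}" for k
  proof -
    have kn: "2 * l + k \<le> n"
      using k by auto
    have "k \<le> card ({1..2 * l + k} - C)"
      using diff_card_le_card_Diff[of C "{1..2 * l + k}"] Cn cardC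
      by (simp add: finite_subset)
    then obtain T where T: "T \<subseteq> {1..2 * l + k} - C" "card T = k"
      by (meson obtain_subset_with_card_n)
    have Tn: "T \<subseteq> {1..n}"
      using T kn by fastforce
    have labT: "inj_on lab T"
      using inj Tn by (rule inj_on_subset)
    \<comment> \<open>Choosing \<open>T\<close> inside \<open>{1..2 * l + k}\<close> pays off here:
      its \<open>k\<close> indices are compared with the last \<open>k\<close> of that
      interval.\<close>
    have "(\<Sum>i=2 * l + 1..2 * l + k. int (d i)) \<le> (\<Sum>i\<in>T. int (d i))"
      using assms(1) kn T
      by (intro sum_antimono_ge_final) (auto simp: arranged_def monotone_on_def)
    also have "\<dots> = (\<Sum>t\<in>lab ` T. int (degree E t))"
      using deg Tn by (subst sum.reindex[OF labT]) (auto intro!: sum.cong)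
    also have "\<dots> \<le> (\<Sum>c\<in>\<Union>M. min (int (degree E c) - 1) (int (card (lab ` T))))"
    proof (rule sum_degree_uncovered_le[OF G assms(3)])
      show "lab ` T \<subseteq> V"
        using lab Tn by (auto simp: bij_betw_def)
      show "lab ` T \<inter> \<Union>M = {}"
        using T(1) Tn unfolding C_def by blast
    qed
    also have "\<dots> = (\<Sum>i\<in>C. min (int (d i) - 1) (int k))"
      unfolding labC[symmetric] card_image[OF labT] T(2)
      using deg Cn by (subst sum.reindex[OF inj_on_subset[OF inj Cn]]) (auto intro!: sum.cong)
    \<comment> \<open>Subtracting 1 and truncating at \<open>k\<close> are monotone, so the summand
      is still antitone in \<open>i\<close>.\<close>
    also have "\<dots> \<le> (\<Sum>i=1..2 * l. min (int (d i) - 1) (int k))"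
      using assms(1) Cn cardC
      by (intro sum_antimono_le_initial[of n]) (fastforce simp: arranged_def monotone_on_def)+
    finally show ?thesis .
  qed
  ultimately have "l \<in> L"
    by (simp add: L_def)
  \<comment> \<open>Finiteness is what makes \<open>Min\<close> a lower bound of
    \<open>L\<close>.\<close>
  moreover have "finite L"
    by (rule finite_subset[of _ "{..n}"]) (auto simp: L_def)
  ultimately show ?thesis
    by (simp add: ell_star_def L_def l_def)
qed

end
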